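(* Let $GP$ be a set of general path axioms. If~$\mathcal{D}$ is a derivation of a nested sequent $X$ in~$\textsf{SKT} + \textit{NestSt(GP)}$, then there is an effective translation of~$\mathcal{D}$ to a derivation~$\mathcal{D}'$ of $\mathfrak{L}(X)$ in~$\mathsf{G3Kt} + \textit{LabSt(GP)}$.
   Context: Tense formulae (in negation normal form) are given by $A ::= p \mid \overline{p} \mid A\wedge A \mid A\vee A \mid \Box A \mid \Diamond A \mid \blacksquare A \mid \Diamond^{-}A$, where $\Diamond^{-}$ denotes the past diamond (the dual of $\blacksquare$). A general path axiom has the form $\langle ? \rangle_{1} \cdots \langle ? \rangle_{n} A \rightarrow \langle ? \rangle_{n+1} \cdots \langle ? \rangle_{n+m} A$ with each $\langle ? \rangle_j \in \{\Diamond,\Diamond^{-}\}$; write it $\Pi A\rightarrow \Sigma A$. Nested sequents: $X ::= \varepsilon \mid A \mid X,X \mid \circ\{X\} \mid \bullet\{X\}$ (comma commutative and associative). $\textsf{SKT}$ has rules: $(\textsf{id})$ $X,p,\overline{p}$; $(\vee)$ from $X,A,B$ infer $X,A\vee B$; $(\wedge)$ from $X,A$ and $X,B$ infer $X,A\wedge B$; contraction from $X,Y,Y$ infer $X,Y$; weakening from $X$ infer $X,Y$; display rules $(\textsf{rf})$ from $X,\circ\{Y\}$ infer $\bullet\{X\},Y$ and $(\textsf{rp})$ from $X,\bullet\{Y\}$ infer $\circ\{X\},Y$; $(\blacksquare)$ from $X,\bullet\{A\}$ infer $X,\blacksquare A$; $(\Box)$ from $X,\circ\{A\}$ infer $X,\Box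 A$; $(\Diamond^{-})$ from $X,\bullet\{Y,A\},\Diamond^{-}A$ infer $X,\bullet\{Y\},\Diamond^{-}A$; $(\Diamond)$ from $X,\circ\{Y,A\},\Diamond A$ infer $X,\circ\{Y\},\Diamond A$. $\textit{NestSt(GP)}$ contains, for each axiom in $GP$, the rule: from $X, \star_{n+1} \{ \cdots \star_{n+m} \{ Y \} \cdots \}$ infer $X, \star_{1} \{ \cdots \star_{n} \{ Y \} \cdots \}$, where $\star_j=\circ$ if $\langle ? \rangle_j=\Diamond$ and $\star_j=\bullet$ if $\langle ? \rangle_j=\Diamond^{-}$. Labeled sequents have the form $\mathcal{R},\Gamma$ with $\mathcal{R}$ a set of relational atoms $Rxy$ and $\Gamma$ a multiset of labeled formulae $x:A$. $\mathsf{G3Kt}$ has rules: $(\textsf{id})$ $\mathcal{R},x:p,x:\overline{p},\Gamma$; $(\vee)$, $(\wedge)$ labelwise; $(\Box)$ from $\mathcal{R},Rxy,y:A,\Gamma$ infer $\mathcal{R},x:\Box A,\Gamma$ ($y$ fresh); $(\Diamond)$ from $\mathcal{R},Rxy,y:A,x:\Diamond A,\Gamma$ infer $\mathcal{R},Rxy,x:\Diamond A,\Gamma$; $(\blacksquare)$ from $\mathcal{R},Ryx,y:A,\Gamma$ infer $\mathcal{R},x:\blacksquare A,\Gamma$ ($y$ fresh); $(\Diamond^{-})$ from $\mathcal{R},Ryx,y:A,x:\Diamond^{-}A,\Gamma$ infer $\mathcal{R},Ryx,x:\Diamond^{-}A,\Gamma$. With $R_{\Diamond}xy:=Rxy$,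 $R_{\Diamond^{-}}xy:=Ryx$ and $\mathcal{R}_{\Pi}xy$ the chain of such atoms from $x$ to $y$ along $\Pi$, $\textit{LabSt(GP)}$ contains for each $\Pi A\rightarrow\Sigma A\in GP$ the rule: from $\mathcal{R},\mathcal{R}_{\Pi}xy,\mathcal{R}_{\Sigma}xy,\Gamma$ infer $\mathcal{R},\mathcal{R}_{\Pi}xy,\Gamma$, where all intermediate labels of $\mathcal{R}_{\Sigma}xy$ are fresh. $\mathfrak{L}$ maps a nested sequent to a labeled sequent: $\mathfrak{L}_x(\varepsilon)$ is empty, $\mathfrak{L}_x(A)=x:A$, $\mathfrak{L}_x(X_1,X_2)=\mathfrak{L}_x(X_1),\mathfrak{L}_x(X_2)$, $\mathfrak{L}_x(\circ\{X\})=Rxy,\mathfrak{L}_y(X)$ and $\mathfrak{L}_x(\bullet\{X\})=Ryx,\mathfrak{L}_y(X)$ with $y$ fresh; the starting label is immaterial up to renaming. "Effective translation" means a local, rule-by-rule transformation of the derivation. *)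

theory Defs
  imports Main "HOL-Library.Multiset"
begin

section \<open>Tense formulae and general path axioms\<close>

datatype 'p fm =
    Pos 'p | Neg 'p
  | And "'p fm" "'p fm" | Or "'p fm" "'p fm"
  | Box "'p fm" | Dia "'p fm"
  | PastBox "'p fm" | PastDia "'p fm"

datatype diamond = Fut | Past

text \<open>The pair \<open>(\<Pi>, \<Sigma>)\<close> stands for the general path axiom \<open>\<Pi>A \<rightarrow> \<Sigma>A\<close>
  (schematic in \<open>A\<close>). Either string may be empty: reflexivity is \<open>([], [Fut])\<close>.\<close>

type_synonym gp_axiom = "diamond list \<times> diamond list"


section \<open>Derivations\<close>

text \<open>Every inference carries the name of its rule. A calculus is a relation between a rule name,
  the list of premises and the conclusion.\<close>

datatype ('r, 's) derivation =
  Infer (last_rule: 'r) (concl: 's) (subderivations: "('r, 's) derivation list")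

inductive derives :: "('r \<Rightarrow> 's list \<Rightarrow> 's \<Rightarrow> bool) \<Rightarrow> ('r, 's) derivation \<Rightarrow> bool"
  for calc :: "'r \<Rightarrow> 's list \<Rightarrow> 's \<Rightarrow> bool"
  where
  "calc r (map concl ds) S \<Longrightarrow> (\<forall>d \<in> set ds. derives calc d) \<Longrightarrow> derives calc (Infer r S ds)"


section \<open>Nested sequents and the calculus SKT + NestSt(GP)\<close>

text \<open>Using multisets makes the comma, written \<open>+\<close>, associative and commutative with the empty
  sequent \<open>{#}\<close> as its unit.\<close>

datatype 'p node =
    Fm "'p fm"
  | Circ "'p node multiset"
  | Bullet "'p node multiset"

type_synonym 'p nested = "'p node multiset"

fun star :: "diamond \<Rightarrow> 'p nested \<Rightarrow> 'p nested" where
  "star Fut X = {#Circ X#}"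
| "star Past X = {#Bullet X#}"

definition stars :: "diamond list \<Rightarrow> 'p nested \<Rightarrow> 'p nested" where
  "stars ds Y = foldr star ds Y"

datatype nested_rule =
    NId | NOr | NAnd | NContr | NWeak | NRf | NRp
  | NPastBox | NBox | NPastDia | NDia
  | NestSt gp_axiom

inductive skt :: "gp_axiom set \<Rightarrow> nested_rule \<Rightarrow> 'p nested list \<Rightarrow> 'p nested \<Rightarrow> bool"
  for GP :: "gp_axiom set"
  where
  "skt GP NId [] (X + {#Fm (Pos p), Fm (Neg p)#})"
| "skt GP NOr [X + {#Fm A, Fm B#}] (X + {#Fm (Or A B)#})"
| "skt GP NAnd [X + {#Fm A#}, X + {#Fm B#}] (X + {#Fm (And A B)#})"
| "skt GP NContr [X + Y + Y] (X + Y)"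
| "skt GP NWeak [X] (X + Y)"
| "skt GP NRf [X + {#Circ Y#}] ({#Bullet X#} + Y)"
| "skt GP NRp [X + {#Bullet Y#}] ({#Circ X#} + Y)"
| "skt GP NPastBox [X + {#Bullet {#Fm A#}#}] (X + {#Fm (PastBox A)#})"
| "skt GP NBox [X + {#Circ {#Fm A#}#}] (X + {#Fm (Box A)#})"
| "skt GP NPastDia [X + {#Bullet (Y + {#Fm A#})#} + {#Fm (PastDia A)#}]
                   (X + {#Bullet Y#} + {#Fm (PastDia A)#})"
| "skt GP NDia [X + {#Circ (Y + {#Fm A#})#} + {#Fm (Dia A)#}]
               (X + {#Circ Y#} + {#Fm (Dia A)#})"
| "(Pi, Sig) \<in> GP \<Longrightarrow> skt GP (NestSt (Pi, Sig)) [X + stars Sig Y] (X + stars Pi Y)"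


section \<open>Labelled sequents and the calculus G3Kt + LabSt(GP)\<close>

type_synonym label = nat

text \<open>The pair \<open>(x, y)\<close> in the first component is the relational atom \<open>Rxy\<close>; the pair
  \<open>(x, A)\<close> in the second component is the labelled formula \<open>x : A\<close>.\<close>

type_synonym 'p labelled = "(label \<times> label) set \<times> (label \<times> 'p fm) multiset"

definition labels :: "'p labelled \<Rightarrow> label set" where
  "labels S = Field (fst S) \<union> fst ` set_mset (snd S)"

definition rename :: "(label \<Rightarrow> label) \<Rightarrow> 'p labelled \<Rightarrow> 'p labelled" where
  "rename f S = (map_prod f f ` fst S, image_mset (map_prod f id) (snd S))"

fun rel_atom :: "diamond \<Rightarrow> label \<Rightarrow> label \<Rightarrow> label \<times> label" where
  "rel_atom Fut x y = (x, y)"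
| "rel_atom Past x y = (y, x)"

text \<open>\<open>chain ds zs\<close> is the chain of atoms along \<open>ds\<close> that visits the labels \<open>zs\<close>; it is an
  \<open>\<R>\<^sub>d\<^sub>s xy\<close> if \<open>zs\<close> is a path from \<open>x\<close> to \<open>y\<close>. For \<open>ds = []\<close> this forces \<open>x = y\<close>.\<close>

definition chain :: "diamond list \<Rightarrow> label list \<Rightarrow> (label \<times> label) set" where
  "chain ds zs = {rel_atom (ds ! i) (zs ! i) (zs ! Suc i) | i. i < length ds}"

definition path :: "diamond list \<Rightarrow> label \<Rightarrow> label list \<Rightarrow> label \<Rightarrow> bool" where
  "path ds x zs y \<longleftrightarrow> length zs = Suc (length ds) \<and> hd zs = x \<and> last zs = y"

definition intermediate :: "label list \<Rightarrow> label list" where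
  "intermediate zs = butlast (tl zs)"

datatype labelled_rule =
    LId | LOr | LAnd | LBox | LDia | LPastBox | LPastDia
  | LabSt gp_axiom

text \<open>The last rule is the case of an axiom \<open>\<Pi>A \<rightarrow> A\<close> with empty consequent. There the empty
  chain from \<open>x\<close> to \<open>y\<close> in the premise expresses that \<open>x\<close> and \<open>y\<close> are the same label, so the
  premise is the conclusion with \<open>y\<close> replaced by \<open>x\<close>; labelled sequents have no equality atoms.\<close>

inductive g3kt ::
    "gp_axiom set \<Rightarrow> labelled_rule \<Rightarrow> 'p labelled list \<Rightarrow> 'p labelled \<Rightarrow> bool"
  for GP :: "gp_axiom set"
  where
  "g3kt GP LId [] (R, {#(x, Pos p), (x, Neg p)#} + G)"
| "g3kt GP LOr [(R, {#(x, A), (x, B)#} + G)] (R, {#(x, Or A B)#} + G)"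
| "g3kt GP LAnd [(R, {#(x, A)#} + G), (R, {#(x, B)#} + G)] (R, {#(x, And A B)#} + G)"
| "y \<notin> labels (R, {#(x, Box A)#} + G) \<Longrightarrow>
   g3kt GP LBox [(R \<union> {(x, y)}, {#(y, A)#} + G)] (R, {#(x, Box A)#} + G)"
| "g3kt GP LDia [(R \<union> {(x, y)}, {#(y, A), (x, Dia A)#} + G)]
                (R \<union> {(x, y)}, {#(x, Dia A)#} + G)"
| "y \<notin> labels (R, {#(x, PastBox A)#} + G) \<Longrightarrow>
   g3kt GP LPastBox [(R \<union> {(y, x)}, {#(y, A)#} + G)] (R, {#(x, PastBox A)#} + G)"
| "g3kt GP LPastDia [(R \<union> {(y, x)}, {#(y, A), (x, PastDia A)#} + G)]
                    (R \<union> {(y, x)}, {#(x, PastDia A)#} + G)"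
| "(Pi, Sig) \<in> GP \<Longrightarrow> Sig \<noteq> [] \<Longrightarrow> path Pi x us y \<Longrightarrow> path Sig x vs y \<Longrightarrow>
   distinct (intermediate vs) \<Longrightarrow>
   set (intermediate vs) \<inter> ({x, y} \<union> labels (R \<union> chain Pi us, G)) = {} \<Longrightarrow>
   g3kt GP (LabSt (Pi, Sig)) [(R \<union> chain Pi us \<union> chain Sig vs, G)] (R \<union> chain Pi us, G)"
| "(Pi, []) \<in> GP \<Longrightarrow> path Pi x us y \<Longrightarrow>
   g3kt GP (LabSt (Pi, [])) [rename (id(y := x)) (R \<union> chain Pi us, G)] (R \<union> chain Pi us, G)"


section \<open>The translation of sequents\<close>

text \<open>\<open>translates x X S\<close> says that \<open>S\<close> is a value of \<open>\<LL>\<^sub>x(X)\<close> for some choice of the fresh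
  labels. Freshness is expressed by the parts of \<open>S\<close> sharing no labels other than the root.\<close>

inductive translates :: "label \<Rightarrow> 'p nested \<Rightarrow> 'p labelled \<Rightarrow> bool" where
  "translates x {#} ({}, {#})"
| "translates x {#Fm A#} ({}, {#(x, A)#})"
| "translates x X1 (R1, G1) \<Longrightarrow> translates x X2 (R2, G2) \<Longrightarrow>
   labels (R1, G1) \<inter> labels (R2, G2) \<subseteq> {x} \<Longrightarrow>
   translates x (X1 + X2) (R1 \<union> R2, G1 + G2)"
| "translates y X (R, G) \<Longrightarrow> x \<notin> {y} \<union> labels (R, G) \<Longrightarrow>
   translates x {#Circ X#} ({(x, y)} \<union> R, G)"
| "translates y X (R, G) \<Longrightarrow> x \<notin> {y} \<union> labels (R, G) \<Longrightarrow>
   translates x {#Bullet X#} ({(y, x)} \<union> R, G)"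

text \<open>A function \<open>\<LL>\<close> that fixes a starting label and the fresh labels for every nested sequent.\<close>

definition sequent_translation :: "('p nested \<Rightarrow> 'p labelled) \<Rightarrow> bool" where
  "sequent_translation L \<longleftrightarrow> (\<forall>X. \<exists>x. translates x X (L X))"

lemma translates_exists_avoiding:
  fixes X :: "'p nested"
  assumes "finite V"
  shows "\<exists>S. translates x X S \<and> finite (labels S) \<and> labels S \<inter> V \<subseteq> {x}"
proof -
  let ?P = "\<lambda>X :: 'p nested. \<forall>x V. finite V \<longrightarrow>
      (\<exists>R G. translates x X (R, G) \<and> finite (labels (R, G)) \<and> labels (R, G) \<inter> V \<subseteq> {x})"
  have multi: "?P X" if "\<forall>n \<in># X. ?P {#n#}" for X :: "'p nested"
    using that
  proof (induction X)
    case empty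
    have "labels ({}, {#} :: (label \<times> 'p fm) multiset) = {}"
      by (simp add: labels_def)
    then show ?case
      using translates.intros(1) by (metis finite.emptyI inf_bot_left empty_subsetI)
  next
    case (add n X)
    show ?case
    proof (intro allI impI)
      fix x :: label and V :: "label set"
      assume V: "finite V"
      obtain R1 G1 where 1: "translates x {#n#} (R1, G1)" "finite (labels (R1, G1))"
          "labels (R1, G1) \<inter> V \<subseteq> {x}"
        using add.prems V by (metis union_single_eq_member)
      have "?P X" using add by simp
      then obtain R2 G2 where 2: "translates x X (R2, G2)" "finite (labels (R2, G2))"
          "labels (R2, G2) \<inter> (V \<union> labels (R1, G1)) \<subseteq> {x}"
        using V 1(2) by (meson finite_UnI)
      have "translates x ({#n#} + X) (R1 \<union> R2, G1 + G2)"
        using 1 2 by (intro translates.intros(3)) auto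
      moreover have "labels (R1 \<union> R2, G1 + G2) = labels (R1, G1) \<union> labels (R2, G2)"
        by (auto simp: labels_def Field_def)
      ultimately show "\<exists>R G. translates x (add_mset n X) (R, G) \<and> finite (labels (R, G)) \<and>
          labels (R, G) \<inter> V \<subseteq> {x}"
        using 1 2 by (intro exI[of _ "R1 \<union> R2"] exI[of _ "G1 + G2"]) auto
    qed
  qed
  have single: "?P {#n#}" for n :: "'p node"
  proof (induction n)
    case (Fm A)
    have "labels ({}, {#(x, A)#}) = {x}" for x
      by (simp add: labels_def)
    then show ?case
      using translates.intros(2) by (metis finite.emptyI finite.insertI inf_le1)
  next
    case (Circ X)
    then have X: "?P X" by (intro multi) blast
    show ?case
    proof (intro allI impI)
      fix x :: label and V :: "label set"
      assume V: "finite V"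
      obtain y where y: "y \<notin> insert x V"
        using V ex_new_if_finite[OF infinite_UNIV_nat] by (metis finite_insert)
      obtain R G where RG: "translates y X (R, G)" "finite (labels (R, G))"
          "labels (R, G) \<inter> insert x V \<subseteq> {y}"
        using X V by (meson finite_insert)
      have "translates x {#Circ X#} ({(x, y)} \<union> R, G)"
        using RG y by (intro translates.intros(4)) auto
      moreover have "labels ({(x, y)} \<union> R, G) = {x, y} \<union> labels (R, G)"
        by (auto simp: labels_def Field_def)
      ultimately show "\<exists>R G. translates x {#Circ X#} (R, G) \<and> finite (labels (R, G)) \<and>
          labels (R, G) \<inter> V \<subseteq> {x}"
        using RG y by (intro exI[of _ "{(x, y)} \<union> R"] exI[of _ G]) auto
    qed
  next
    case (Bullet X)
    then have X: "?P X" by (intro multi) blast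
    show ?case
    proof (intro allI impI)
      fix x :: label and V :: "label set"
      assume V: "finite V"
      obtain y where y: "y \<notin> insert x V"
        using V ex_new_if_finite[OF infinite_UNIV_nat] by (metis finite_insert)
      obtain R G where RG: "translates y X (R, G)" "finite (labels (R, G))"
          "labels (R, G) \<inter> insert x V \<subseteq> {y}"
        using X V by (meson finite_insert)
      have "translates x {#Bullet X#} ({(y, x)} \<union> R, G)"
        using RG y by (intro translates.intros(5)) auto
      moreover have "labels ({(y, x)} \<union> R, G) = {x, y} \<union> labels (R, G)"
        by (auto simp: labels_def Field_def)
      ultimately show "\<exists>R G. translates x {#Bullet X#} (R, G) \<and> finite (labels (R, G)) \<and>
          labels (R, G) \<inter> V \<subseteq> {x}"
        using RG y by (intro exI[of _ "{(y, x)} \<union> R"] exI[of _ G]) auto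
    qed
  qed
  show ?thesis using multi[of X] single assms by blast
qed

lemma sequent_translation_exists: "\<exists>L :: 'p nested \<Rightarrow> 'p labelled. sequent_translation L"
proof -
  have "\<forall>X :: 'p nested. \<exists>S. translates 0 X S"
    using translates_exists_avoiding[of "{}"] by blast
  then show ?thesis unfolding sequent_translation_def by metis
qed


section \<open>Effective translations of derivations\<close>

text \<open>\<open>embeds e d\<close>: as a tree of rule names, \<open>e\<close> is homeomorphically embedded in \<open>d\<close>. The
  sequents are unconstrained, so this is how a derivation changes when it is relabelled, weakened,
  contracted or inverted: inferences may be dropped and sequents adjusted, but no inference is
  added.\<close>

inductive embeds :: "('r, 's) derivation \<Rightarrow> ('r, 's) derivation \<Rightarrow> bool" where
  "list_all2 embeds es ds \<Longrightarrow> embeds (Infer r S es) (Infer r T ds)"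
| "d \<in> set ds \<Longrightarrow> embeds e d \<Longrightarrow> embeds e (Infer r T ds)"

text \<open>\<open>built es n e\<close>: \<open>e\<close> consists of \<open>n\<close> inferences on top of which sit members of \<open>es\<close>,
  each up to a change as above.\<close>

inductive built :: "('r, 's) derivation list \<Rightarrow> nat \<Rightarrow> ('r, 's) derivation \<Rightarrow> bool"
  for es :: "('r, 's) derivation list"
  where
  "d \<in> set es \<Longrightarrow> embeds e d \<Longrightarrow> built es 0 e"
| "list_all2 (built es) ns ds \<Longrightarrow> built es (Suc (sum_list ns)) (Infer r S ds)"

text \<open>\<open>step r Xs X es\<close> simulates the inference by rule \<open>r\<close> from \<open>Xs\<close> to \<open>X\<close>, given derivations
  \<open>es\<close> of the translated premises. It is local: it must work for any such \<open>es\<close>, and it builds its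
  result from \<open>es\<close> with a number of new inferences that depends on the rule alone.\<close>

definition local_simulation ::
    "gp_axiom set \<Rightarrow> ('p nested \<Rightarrow> 'p labelled) \<Rightarrow>
     (nested_rule \<Rightarrow> 'p nested list \<Rightarrow> 'p nested \<Rightarrow>
       (labelled_rule, 'p labelled) derivation list \<Rightarrow> (labelled_rule, 'p labelled) derivation) \<Rightarrow>
     bool" where
  "local_simulation GP L step \<longleftrightarrow>
     (\<exists>k :: nested_rule \<Rightarrow> nat. \<forall>r Xs X es.
        skt GP r Xs X \<longrightarrow> (\<forall>e \<in> set es. derives (g3kt GP) e) \<longrightarrow> map concl es = map L Xs \<longrightarrow>
        derives (g3kt GP) (step r Xs X es) \<and> concl (step r Xs X es) = L X \<and>
        (\<exists>n \<le> k r. built es n (step r Xs X es)))"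

primrec rule_by_rule ::
    "('r \<Rightarrow> 's list \<Rightarrow> 's \<Rightarrow> 'd list \<Rightarrow> 'd) \<Rightarrow> ('r, 's) derivation \<Rightarrow> 'd" where
  "rule_by_rule step (Infer r X ds) = step r (map concl ds) X (map (rule_by_rule step) ds)"

definition effective_translation ::
    "gp_axiom set \<Rightarrow> ('p nested \<Rightarrow> 'p labelled) \<Rightarrow>
     ((nested_rule, 'p nested) derivation \<Rightarrow> (labelled_rule, 'p labelled) derivation) \<Rightarrow> bool" where
  "effective_translation GP L T \<longleftrightarrow>
     (\<exists>step. local_simulation GP L step \<and> T = rule_by_rule step)"

end

theory Submission
  imports Defs
begin

text \<open>A nested sequent holds at a label of a labelled sequent if its tree maps into it, and a
  translation of \<open>X\<close> is initial among the labelled sequents where \<open>X\<close> holds. So it suffices to lift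
  derivations along maps of labelled sequents, without new inferences: this one statement contains
  the admissibility of relabelling, weakening and contraction. To get contraction without separate
  inversion lemmas, a map may send a formula to components it decomposes into.
  The structural and display rules then need no inference, every other rule at most one.\<close>

section \<open>Coverage of formulae and maps between labelled sequents\<close>

text \<open>The further disjuncts describe what is left of a formula once its rule has been applied
  bottom up: both components for \<open>Or\<close>, one component in each premise for
  \<open>And\<close>, the component at a neighbouring label for the boxes. The diamond rules keep
  their principal formula, so a diamond has to be present itself.\<close>

fun covers :: "'p labelled \<Rightarrow> label \<Rightarrow> 'p fm \<Rightarrow> bool" where
  "covers S x (Pos p) \<longleftrightarrow> (x, Pos p) \<in># snd S"
| "covers S x (Neg p) \<longleftrightarrow> (x, Neg p) \<in># snd S"
| "covers S x (And A B) \<longleftrightarrow> (x, And A B) \<in># snd S \<or> covers S x A \<or> covers S x B"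
| "covers S x (Or A B) \<longleftrightarrow> (x, Or A B) \<in># snd S \<or> covers S x A \<and> covers S x B"
| "covers S x (Box A) \<longleftrightarrow> (x, Box A) \<in># snd S \<or> (\<exists>y. (x, y) \<in> fst S \<and> covers S y A)"
| "covers S x (PastBox A) \<longleftrightarrow> (x, PastBox A) \<in># snd S \<or> (\<exists>y. (y, x) \<in> fst S \<and> covers S y A)"
| "covers S x (Dia A) \<longleftrightarrow> (x, Dia A) \<in># snd S"
| "covers S x (PastDia A) \<longleftrightarrow> (x, PastDia A) \<in># snd S"

definition maps_into :: "(label \<Rightarrow> label) \<Rightarrow> 'p labelled \<Rightarrow> 'p labelled \<Rightarrow> bool" where
  "maps_into f S T \<longleftrightarrow>
     (\<forall>(x, y) \<in> fst S. (f x, f y) \<in> fst T) \<and> (\<forall>(x, A) \<in># snd S. covers T (f x) A)"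

lemma maps_intoI:
  assumes "\<And>x y. (x, y) \<in> fst S \<Longrightarrow> (f x, f y) \<in> fst T"
    and "\<And>x A. (x, A) \<in># snd S \<Longrightarrow> covers T (f x) A"
  shows "maps_into f S T"
  using assms by (auto simp: maps_into_def)

lemma maps_into_rel: "maps_into f S T \<Longrightarrow> (x, y) \<in> fst S \<Longrightarrow> (f x, f y) \<in> fst T"
  by (auto simp: maps_into_def)

lemma maps_into_fm: "maps_into f S T \<Longrightarrow> (x, A) \<in># snd S \<Longrightarrow> covers T (f x) A"
  by (auto simp: maps_into_def)

lemma covers_mem: "(x, A) \<in># snd S \<Longrightarrow> covers S x A"
  by (cases A) auto

text \<open>A formula present in \<open>S\<close> is covered in \<open>T\<close> by the definition
  of a map; a decomposed one follows from the induction hypotheses, the map carrying the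
  neighbouring label along. Hence maps compose although they need not preserve formulae.\<close>

lemma covers_map: "maps_into f S T \<Longrightarrow> covers S x A \<Longrightarrow> covers T (f x) A"
proof (induction A arbitrary: x)
  case (Pos p) then show ?case using maps_into_fm by fastforce
next
  case (Neg p) then show ?case using maps_into_fm by fastforce
next
  case (And A B) then show ?case using maps_into_fm[OF And.prems(1)] by (metis covers.simps(3))
next
  case (Or A B) then show ?case using maps_into_fm[OF Or.prems(1)] by (metis covers.simps(4))
next
  case (Box A)
  then show ?case
    using maps_into_fm[OF Box.prems(1)] maps_into_rel[OF Box.prems(1)] by (metis covers.simps(5))
next
  case (Dia A) then show ?case using maps_into_fm by fastforce
next
  case (PastBox A)
  then show ?case
    using maps_into_fm[OF PastBox.prems(1)] maps_into_rel[OF PastBox.prems(1)]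
    by (metis covers.simps(6))
next
  case (PastDia A) then show ?case using maps_into_fm by fastforce
qed

lemma maps_into_refl [simp]: "maps_into id S S"
  by (rule maps_intoI) (auto intro: covers_mem)

lemma maps_into_comp: "maps_into f S T \<Longrightarrow> maps_into g T U \<Longrightarrow> maps_into (g \<circ> f) S U"
  by (rule maps_intoI) (metis comp_apply maps_into_rel, metis comp_apply maps_into_fm covers_map)

lemma maps_into_id_comp: "maps_into f S T \<Longrightarrow> maps_into id T U \<Longrightarrow> maps_into f S U"
  using maps_into_comp[of f S T id U] by simp

lemma labels_rel: "(x, y) \<in> fst S \<Longrightarrow> x \<in> labels S \<and> y \<in> labels S"
  by (auto simp: labels_def Field_def)

lemma labels_fm: "(x, A) \<in># snd S \<Longrightarrow> x \<in> labels S"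
  by (force simp: labels_def)

text \<open>Only the values on labels of \<open>S\<close> matter, so the image of a fresh label can
  be chosen freely.\<close>

lemma maps_into_cong:
  assumes "maps_into f S T" "\<And>z. z \<in> labels S \<Longrightarrow> g z = f z"
  shows "maps_into g S T"
  using assms
  by (intro maps_intoI) (metis labels_rel maps_into_rel, metis labels_fm maps_into_fm)

lemma finite_labels: "finite (fst S) \<Longrightarrow> finite (labels S)"
  by (simp add: labels_def finite_Field)

section \<open>Chains of relational atoms as walks\<close>

text \<open>Hides the labels visited by a \<open>chain\<close> inside \<open>R\<close>; its
  recursion on the diamond string matches that of \<open>stars\<close>.\<close>

fun walk :: "(label \<times> label) set \<Rightarrow> diamond list \<Rightarrow> label \<Rightarrow> label \<Rightarrow> bool" where
  "walk R [] x y \<longleftrightarrow> x = y"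
| "walk R (d # ds) x y \<longleftrightarrow> (\<exists>z. rel_atom d x z \<in> R \<and> walk R ds z y)"

lemma chain_Nil: "chain [] zs = {}"
  by (simp add: chain_def)

lemma chain_Cons: "chain (d # ds) (x # z # zs) = insert (rel_atom d x z) (chain ds (z # zs))"
proof -
  have *: "{f i |i. i < Suc n} = insert (f 0) {f (Suc i) |i. i < n}"
    for f :: "nat \<Rightarrow> label \<times> label" and n
    by (auto simp: less_Suc_eq_0_disj)
  show ?thesis
    unfolding chain_def using *[of "\<lambda>i. rel_atom ((d # ds) ! i) ((x # z # zs) ! i) ((x # z # zs) ! Suc i)"]
    by simp
qed

lemma path_Nil: "path [] x zs y \<longleftrightarrow> zs = [x] \<and> x = y"
  by (auto simp: path_def length_Suc_conv)

lemma path_Cons: "path (d # ds) x zs y \<longleftrightarrow> (\<exists>z us. zs = x # z # us \<and> path ds z (z # us) y)"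
  by (cases zs; cases "tl zs") (auto simp: path_def)

lemma walk_iff_path: "walk R ds x y \<longleftrightarrow> (\<exists>zs. path ds x zs y \<and> chain ds zs \<subseteq> R)"
proof (induction ds arbitrary: x)
  case Nil
  then show ?case by (auto simp: path_Nil chain_Nil)
next
  case (Cons d ds)
  have hd: "path ds z zs y \<Longrightarrow> \<exists>us. zs = z # us" for z zs
    by (cases zs) (auto simp: path_def)
  show ?case
  proof
    assume "walk R (d # ds) x y"
    then obtain z zs where "rel_atom d x z \<in> R" "path ds z zs y" "chain ds zs \<subseteq> R"
      using Cons.IH by auto
    moreover from this obtain us where "zs = z # us" using hd by blast
    ultimately show "\<exists>zs. path (d # ds) x zs y \<and> chain (d # ds) zs \<subseteq> R"
      by (intro exI[of _ "x # z # us"]) (simp add: chain_Cons path_Cons)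
  next
    assume "\<exists>zs. path (d # ds) x zs y \<and> chain (d # ds) zs \<subseteq> R"
    then obtain z us where "path ds z (z # us) y" "chain (d # ds) (x # z # us) \<subseteq> R"
      by (auto simp: path_Cons)
    then show "walk R (d # ds) x y"
      using Cons.IH[of z] by (auto simp: chain_Cons)
  qed
qed

lemma rel_atom_map: "map_prod f f (rel_atom d x y) = rel_atom d (f x) (f y)"
  by (cases d) auto

lemma chain_map:
  assumes "length zs = Suc (length ds)"
  shows "chain ds (map f zs) = map_prod f f ` chain ds zs"
proof -
  have "rel_atom (ds ! i) (map f zs ! i) (map f zs ! Suc i)
      = map_prod f f (rel_atom (ds ! i) (zs ! i) (zs ! Suc i))" if "i < length ds" for i
    using that assms by (simp add: rel_atom_map)
  then show ?thesis
    unfolding chain_def setcompr_eq_image image_image by (intro image_cong) simp_all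
qed

lemma path_map: "path ds x zs y \<Longrightarrow> path ds (f x) (map f zs) (f y)"
  by (cases "zs = []") (auto simp: path_def hd_map last_map)

lemma finite_chain [simp]: "finite (chain ds zs)"
  by (simp add: chain_def)

lemma walk_map:
  assumes "maps_into f S T" "walk (fst S) ds x y"
  shows "walk (fst T) ds (f x) (f y)"
proof -
  obtain zs where zs: "path ds x zs y" "chain ds zs \<subseteq> fst S"
    using assms(2) walk_iff_path by blast
  have "chain ds (map f zs) = map_prod f f ` chain ds zs"
    using zs(1) by (intro chain_map) (simp add: path_def)
  then have "chain ds (map f zs) \<subseteq> fst T"
    using zs(2) maps_into_rel[OF assms(1)] by auto
  then show ?thesis using zs path_map walk_iff_path by blast
qed

text \<open>For a nonempty string the two ends occupy different positions of the list, even if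
  \<open>x = y\<close>; what lies between them is one label fewer than there are atoms.\<close>

lemma path_intermediate:
  assumes "path ds x zs y" "ds \<noteq> []"
  shows "zs = x # intermediate zs @ [y]" "Suc (length (intermediate zs)) = length ds"
proof -
  obtain d ds' where ds: "ds = d # ds'" using assms(2) by (cases ds) auto
  obtain us where zs: "zs = x # us" "length us = length ds" "last us = y" "us \<noteq> []"
    using assms(1) unfolding ds by (auto simp: path_Cons) (auto simp: path_def)
  then show "zs = x # intermediate zs @ [y]" "Suc (length (intermediate zs)) = length ds"
    unfolding intermediate_def using append_butlast_last_id[of us] ds by auto
qed

section \<open>Relabelled sequents and finiteness\<close>

lemma maps_into_rename: "maps_into f S (rename f S)"
  by (rule maps_intoI) (force simp: rename_def intro!: covers_mem)+

text \<open>The atoms and formulae of \<open>rename f S\<close> are exactly the images of those of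
  \<open>S\<close>. This serves the rule for an empty consequent, where a map that identifies the
  end points has to factor through the renaming.\<close>

lemma maps_into_rename_iff: "maps_into g (rename f S) T \<longleftrightarrow> maps_into (g \<circ> f) S T"
  by (auto simp: maps_into_def rename_def)

text \<open>A premise adds finitely many atoms or is a renaming, so fresh labels stay available when
  rules are applied bottom up.\<close>

lemma g3kt_finite: "g3kt GP r Ss S \<Longrightarrow> finite (fst S) \<Longrightarrow> T \<in> set Ss \<Longrightarrow> finite (fst T)"
  by (induction rule: g3kt.induct) (auto simp: rename_def)

section \<open>Single inferences applied bottom up\<close>

lemma labelled_split:
  assumes "(x, A) \<in># snd S"
  obtains R G where "S = (R, {#(x, A)#} + G)"
  using assms multi_member_split[OF assms] by (cases S) auto

lemma id_step:
  assumes "covers S x (Pos p)" "covers S x (Neg p)"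
  shows "g3kt GP LId [] S"
proof -
  obtain R G where S: "S = (R, {#(x, Pos p)#} + G)"
    using labelled_split[of x "Pos p" S] assms(1) by auto
  \<comment> \<open>The two literals differ, so the negative one is still present after the positive
    one is split off.\<close>
  then obtain H where "G = add_mset (x, Neg p) H"
    using assms(2) by (auto dest!: multi_member_split)
  then have "S = (R, {#(x, Pos p), (x, Neg p)#} + H)" using S by simp
  then show ?thesis by (simp only: g3kt.intros(1))
qed

text \<open>The disjunct \<open>S' = S\<close> is the case of a formula that is already decomposed in \<open>S\<close>: there the
  inference is dropped.\<close>

lemma or_step:
  assumes "covers S x (Or A B)"
  shows "\<exists>S'. maps_into id S S' \<and> covers S' x A \<and> covers S' x B \<and>
    (S' = S \<or> g3kt GP LOr [S'] S)"
proof (cases "(x, Or A B) \<in># snd S")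
  case True
  then obtain R G where S: "S = (R, {#(x, Or A B)#} + G)"
    by (rule labelled_split)
  let ?S = "(R, {#(x, A), (x, B)#} + G)"
  have AB: "covers ?S x A" "covers ?S x B" by (auto intro: covers_mem)
  then have "maps_into id S ?S" unfolding S by (intro maps_intoI) (auto intro: covers_mem)
  then show ?thesis using AB unfolding S by (metis g3kt.intros(2))
next
  case False
  then show ?thesis using assms by (intro exI[of _ S]) auto
qed

text \<open>The first two disjuncts belong to a conjunction already decomposed in \<open>S\<close>:
  a derivation of the matching premise then replaces the whole inference, and the other premise is
  discarded.\<close>

lemma and_step:
  assumes "covers S x (And A B)"
  shows "covers S x A \<or> covers S x B \<or> (\<exists>S1 S2. maps_into id S S1 \<and> covers S1 x A \<and>
    maps_into id S S2 \<and> covers S2 x B \<and> g3kt GP LAnd [S1, S2] S)"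
proof (cases "(x, And A B) \<in># snd S")
  case True
  then obtain R G where S: "S = (R, {#(x, And A B)#} + G)"
    by (rule labelled_split)
  let ?S1 = "(R, {#(x, A)#} + G)" and ?S2 = "(R, {#(x, B)#} + G)"
  have AB: "covers ?S1 x A" "covers ?S2 x B" by (auto intro: covers_mem)
  then have "maps_into id S ?S1" "maps_into id S ?S2"
    unfolding S by (intro maps_intoI; auto intro: covers_mem)+
  then show ?thesis using AB unfolding S by (metis g3kt.intros(3))
next
  case False
  then show ?thesis using assms by auto
qed

lemma fresh_label:
  assumes "finite (fst S)"
  obtains y where "y \<notin> labels S"
  using ex_new_if_finite[OF infinite_UNIV_nat finite_labels[OF assms]] by blast

text \<open>A box present in \<open>S\<close> receives a fresh successor by the rule; a decomposed
  one already has a suitable successor, and no inference is made.\<close>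

lemma box_step:
  assumes "covers S x (Box A)" "finite (fst S)"
  shows "\<exists>S' y. maps_into id S S' \<and> (x, y) \<in> fst S' \<and> covers S' y A \<and>
    (S' = S \<or> g3kt GP LBox [S'] S)"
proof (cases "(x, Box A) \<in># snd S")
  case True
  then obtain R G where S: "S = (R, {#(x, Box A)#} + G)"
    by (rule labelled_split)
  obtain y where y: "y \<notin> labels S" using fresh_label assms(2) .
  let ?S = "(R \<union> {(x, y)}, {#(y, A)#} + G)"
  have A: "covers ?S y A" by (auto intro: covers_mem)
  then have "maps_into id S ?S" unfolding S by (intro maps_intoI) (auto intro: covers_mem)
  moreover have "g3kt GP LBox [?S] S" using y unfolding S by (rule g3kt.intros(4))
  ultimately show ?thesis using A by (intro exI[of _ ?S] exI[of _ y]) auto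
next
  case False
  then show ?thesis using assms by (intro exI[of _ S]) auto
qed

lemma past_box_step:
  assumes "covers S x (PastBox A)" "finite (fst S)"
  shows "\<exists>S' y. maps_into id S S' \<and> (y, x) \<in> fst S' \<and> covers S' y A \<and>
    (S' = S \<or> g3kt GP LPastBox [S'] S)"
proof (cases "(x, PastBox A) \<in># snd S")
  case True
  then obtain R G where S: "S = (R, {#(x, PastBox A)#} + G)"
    by (rule labelled_split)
  obtain y where y: "y \<notin> labels S" using fresh_label assms(2) .
  let ?S = "(R \<union> {(y, x)}, {#(y, A)#} + G)"
  have A: "covers ?S y A" by (auto intro: covers_mem)
  then have "maps_into id S ?S" unfolding S by (intro maps_intoI) (auto intro: covers_mem)
  moreover have "g3kt GP LPastBox [?S] S" using y unfolding S by (rule g3kt.intros(6))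
  ultimately show ?thesis using A by (intro exI[of _ ?S] exI[of _ y]) auto
next
  case False
  then show ?thesis using assms by (intro exI[of _ S]) auto
qed

text \<open>A covered diamond is literally present and survives in the premise, so the rule always
  applies and no case is dropped.\<close>

lemma dia_step:
  assumes "covers S x (Dia A)" "(x, y) \<in> fst S"
  shows "\<exists>S'. maps_into id S S' \<and> covers S' y A \<and> g3kt GP LDia [S'] S"
proof -
  \<comment> \<open>The whole relational part can serve as \<open>R\<close>, since it already
    contains the atom.\<close>
  obtain R G where S: "S = (R \<union> {(x, y)}, {#(x, Dia A)#} + G)"
    using assms labelled_split[of x "Dia A" S]
    by (metis Un_insert_right covers.simps(7) fst_conv insert_absorb sup_bot_right)
  let ?S = "(R \<union> {(x, y)}, {#(y, A), (x, Dia A)#} + G)"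
  have "maps_into id S ?S" unfolding S by (intro maps_intoI) (auto intro: covers_mem)
  moreover have "covers ?S y A" by (rule covers_mem) simp
  moreover have "g3kt GP LDia [?S] S" unfolding S by (rule g3kt.intros(5))
  ultimately show ?thesis by blast
qed

lemma past_dia_step:
  assumes "covers S x (PastDia A)" "(y, x) \<in> fst S"
  shows "\<exists>S'. maps_into id S S' \<and> covers S' y A \<and> g3kt GP LPastDia [S'] S"
proof -
  obtain R G where S: "S = (R \<union> {(y, x)}, {#(x, PastDia A)#} + G)"
    using assms labelled_split[of x "PastDia A" S]
    by (metis Un_insert_right covers.simps(8) fst_conv insert_absorb sup_bot_right)
  let ?S = "(R \<union> {(y, x)}, {#(y, A), (x, PastDia A)#} + G)"
  have "maps_into id S ?S" unfolding S by (intro maps_intoI) (auto intro: covers_mem)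
  moreover have "covers ?S y A" by (rule covers_mem) simp
  moreover have "g3kt GP LPastDia [?S] S" unfolding S by (rule g3kt.intros(7))
  ultimately show ?thesis by blast
qed

lemma fresh_list:
  assumes "finite (V :: label set)"
  shows "\<exists>I. length I = n \<and> distinct I \<and> set I \<inter> V = {}"
proof -
  have "infinite (- V)" using assms by (simp add: finite_compl)
  then obtain W where W: "W \<subseteq> - V" "card W = n" "finite W"
    by (metis infinite_arbitrarily_large)
  obtain I where "set I = W" "distinct I" using finite_distinct_list[OF W(3)] by blast
  then show ?thesis using W distinct_card[of I] by (intro exI[of _ I]) auto
qed

text \<open>The map is the identity unless \<open>Sig = []\<close>, where it identifies the end points.\<close>

lemma path_step:
  assumes GP: "(Pi, Sig) \<in> GP" and walk: "walk (fst S) Pi x y" and fin: "finite (fst S)"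
  shows "\<exists>S' g. maps_into g S S' \<and> walk (fst S') Sig (g x) (g y) \<and>
    g3kt GP (LabSt (Pi, Sig)) [S'] S"
proof -
  obtain us where us: "path Pi x us y" "chain Pi us \<subseteq> fst S"
    using walk walk_iff_path by blast
  obtain R G where S: "S = (R \<union> chain Pi us, G)"
    using us(2) that[of "fst S" "snd S"] by (simp add: Un_absorb2)
  show ?thesis
  proof (cases "Sig = []")
    case True
    let ?g = "id(y := x)"
    have "g3kt GP (LabSt (Pi, Sig)) [rename ?g S] S"
      using GP us(1) g3kt.intros(9) unfolding True S by blast
    then show ?thesis
      using True maps_into_rename[of ?g S] by (intro exI[of _ "rename ?g S"] exI[of _ ?g]) auto
  next
    case False
    \<comment> \<open>The end points are avoided separately: for empty \<open>Pi\<close> they need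
      not occur in \<open>S\<close>.\<close>
    have "finite ({x, y} \<union> labels S)" using fin finite_labels by blast
    then obtain I where I: "length I = length Sig - 1" "distinct I" "set I \<inter> ({x, y} \<union> labels S) = {}"
      using fresh_list by meson
    let ?vs = "x # I @ [y]" and ?S = "(R \<union> chain Pi us \<union> chain Sig (x # I @ [y]), G)"
    have vs: "path Sig x ?vs y" using False I by (cases Sig) (auto simp: path_def)
    moreover have "intermediate ?vs = I" by (simp add: intermediate_def)
    ultimately have "g3kt GP (LabSt (Pi, Sig)) [?S] S"
      using GP us(1) I False unfolding S by (intro g3kt.intros(8)) auto
    moreover have "maps_into id S ?S"
      unfolding S by (intro maps_intoI) (auto intro: covers_mem)
    moreover have "walk (fst ?S) Sig x y"
      unfolding walk_iff_path using vs by (intro exI[of _ ?vs]) auto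
    ultimately show ?thesis by (intro exI[of _ ?S] exI[of _ id]) auto
  qed
qed

section \<open>Lifting derivations along maps\<close>

lemma embeds_Infer1: "embeds e d \<Longrightarrow> embeds (Infer r S [e]) (Infer r T [d])"
  by (rule embeds.intros(1)) simp

lemma embeds_drop: "d \<in> set ds \<Longrightarrow> embeds e d \<Longrightarrow> embeds e (Infer r T ds)"
  by (rule embeds.intros(2))

lemma derives_Infer1: "calc r [concl e] S \<Longrightarrow> derives calc e \<Longrightarrow> derives calc (Infer r S [e])"
  by (rule derives.intros) simp_all

text \<open>If \<open>S' = S\<close>, the lifted derivation of the premise is already the result and
  the last inference disappears; otherwise the rule of the same name is put below it. Either way the
  result embeds into the original.\<close>

lemma lift_map_one_premise:
  assumes IH: "\<And>f S. maps_into f (concl d) S \<Longrightarrow> finite (fst S) \<Longrightarrow>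
      \<exists>e. derives (g3kt GP) e \<and> concl e = S \<and> embeds e d"
    and fin: "finite (fst S)"
    and S': "S' = S \<or> g3kt GP r [S'] S" "maps_into f (concl d) S'"
  shows "\<exists>e. derives (g3kt GP) e \<and> concl e = S \<and> embeds e (Infer r T [d])"
proof -
  have "finite (fst S')" using S'(1) fin by (auto dest: g3kt_finite)
  then obtain e where e: "derives (g3kt GP) e" "concl e = S'" "embeds e d"
    using IH S'(2) by blast
  show ?thesis
  proof (cases "S' = S")
    case True
    then show ?thesis using e embeds_drop[of d "[d]" e r T] by auto
  next
    case False
    then have "derives (g3kt GP) (Infer r S [e])" using S'(1) e by (intro derives_Infer1) auto
    then show ?thesis using e(3) embeds_Infer1[of e d r S T] by (intro exI[of _ "Infer r S [e]"]) auto
  qed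
qed

text \<open>By induction on \<open>d\<close> with \<open>f\<close> and \<open>S\<close> arbitrary.
  The principal formula is covered in \<open>S\<close>, so the same rule applies to \<open>S\<close>
  bottom up unless the formula is decomposed there; a path rule applies because the image of its
  chain is again a chain. In each case the map is adjusted to the premises.\<close>

lemma lift_map:
  assumes "derives (g3kt GP) d" "maps_into f (concl d) S" "finite (fst S)"
  shows "\<exists>e. derives (g3kt GP) e \<and> concl e = S \<and> embeds e d"
  using assms
proof (induction arbitrary: f S rule: derives.induct)
  case (1 r ds T)
  have f: "maps_into f T S" using "1.prems" by simp
  have fin: "finite (fst S)" by fact
  have IH: "\<exists>e. derives (g3kt GP) e \<and> concl e = S \<and> embeds e d"
    if "d \<in> set ds" "maps_into f (concl d) S" "finite (fst S)" for d f S
    using "1.IH" that by blast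
  have one: "\<exists>e. derives (g3kt GP) e \<and> concl e = S \<and> embeds e (Infer r T ds)"
    if prem: "map concl ds = [T']" "maps_into f' T' S'" "S' = S \<or> g3kt GP r [S'] S" for T' f' S'
  proof -
    obtain d where d: "ds = [d]" "concl d = T'"
      using prem(1) by (auto simp: map_eq_Cons_conv)
    show ?thesis
      using lift_map_one_premise[of d GP S S' r f' T] IH prem d fin by auto
  qed
  from 1(1) show ?case
  proof cases
    case (1 R x p G)
    have "g3kt GP LId [] S"
      using id_step[of S "f x" p] maps_into_fm[OF f, of x "Pos p"] maps_into_fm[OF f, of x "Neg p"] 1 by auto
    then have "derives (g3kt GP) (Infer LId S [])" by (intro derives.intros) auto
    moreover have "embeds (Infer LId S []) (Infer r T ds)"
      using 1 by (auto intro: embeds.intros)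
    ultimately show ?thesis by (intro exI[of _ "Infer LId S []"]) auto
  next
    case (2 R x A B G)
    have A: "covers S (f x) (Or A B)" by (rule maps_into_fm[OF f]) (simp add: 2)
    from or_step[OF A, of GP]
    obtain S' where S': "maps_into id S S'" "covers S' (f x) A" "covers S' (f x) B"
        "S' = S \<or> g3kt GP LOr [S'] S"
      by blast
    have "maps_into f T S'" using f S'(1) by (rule maps_into_id_comp)
    then have "maps_into f (R, {#(x, A), (x, B)#} + G) S'"
      using S' unfolding 2 by (auto simp: maps_into_def)
    from one[OF 2(2) this] S'(4) 2(1) show ?thesis by simp
  next
    case (3 R x A G B)
    obtain d1 d2 where ds: "ds = [d1, d2]" "concl d1 = (R, {#(x, A)#} + G)"
        "concl d2 = (R, {#(x, B)#} + G)"
      using 3(2) by (auto simp: map_eq_Cons_conv)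
    have m1: "maps_into f (concl d1) S'" if "maps_into id S S'" "covers S' (f x) A" for S'
      using maps_into_id_comp[OF f that(1)] that(2) ds 3 by (auto simp: maps_into_def)
    have m2: "maps_into f (concl d2) S'" if "maps_into id S S'" "covers S' (f x) B" for S'
      using maps_into_id_comp[OF f that(1)] that(2) ds 3 by (auto simp: maps_into_def)
    have "covers S (f x) (And A B)" by (rule maps_into_fm[OF f]) (simp add: 3)
    from and_step[OF this, of GP] show ?thesis
    proof (elim disjE exE conjE)
      assume "covers S (f x) A"
      then show ?thesis using IH[OF _ m1 fin] ds embeds_drop[of d1 ds _ r T] by auto
    next
      assume "covers S (f x) B"
      then show ?thesis using IH[OF _ m2 fin] ds embeds_drop[of d2 ds _ r T] by auto
    next
      fix S1 S2
      assume *: "maps_into id S S1" "covers S1 (f x) A" "maps_into id S S2" "covers S2 (f x) B"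
        "g3kt GP LAnd [S1, S2] S"
      have "finite (fst S1)" "finite (fst S2)" using g3kt_finite[OF *(5) fin] by auto
      then obtain e1 e2 where e: "derives (g3kt GP) e1" "concl e1 = S1" "embeds e1 d1"
          "derives (g3kt GP) e2" "concl e2 = S2" "embeds e2 d2"
        using IH[OF _ m1] IH[OF _ m2] * ds by (metis list.set_intros)
      have "derives (g3kt GP) (Infer LAnd S [e1, e2])"
        using e * by (intro derives.intros) auto
      moreover have "embeds (Infer LAnd S [e1, e2]) (Infer r T ds)"
        unfolding ds 3(1) using e by (intro embeds.intros(1)) auto
      ultimately show ?thesis by (intro exI[of _ "Infer LAnd S [e1, e2]"]) auto
    qed
  next
    case (4 y R x A G)
    have A: "covers S (f x) (Box A)" by (rule maps_into_fm[OF f]) (simp add: 4)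
    from box_step[OF A fin, of GP]
    obtain S' y' where S': "maps_into id S S'" "(f x, y') \<in> fst S'" "covers S' y' A"
        "S' = S \<or> g3kt GP LBox [S'] S"
      by blast
    have x: "x \<noteq> y" using 4 by (auto simp: labels_def)
    have "maps_into f T S'" using f S'(1) by (rule maps_into_id_comp)
    \<comment> \<open>The eigenlabel \<open>y\<close> does not occur in \<open>T\<close>, so it may
      be sent to the successor \<open>y'\<close> found in \<open>S'\<close>.\<close>
    then have "maps_into (f(y := y')) T S'" using 4 by (auto intro: maps_into_cong)
    then have "maps_into (f(y := y')) (R \<union> {(x, y)}, {#(y, A)#} + G) S'"
      using S' x unfolding 4 by (auto simp: maps_into_def)
    from one[OF 4(2) this] S'(4) 4(1) show ?thesis by simp
  next
    case (5 R x y A G)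
    have A: "covers S (f x) (Dia A)" by (rule maps_into_fm[OF f]) (simp add: 5)
    have "(f x, f y) \<in> fst S" by (rule maps_into_rel[OF f]) (simp add: 5)
    from dia_step[OF A this, of GP]
    obtain S' where S': "maps_into id S S'" "covers S' (f y) A" "g3kt GP LDia [S'] S"
      by blast
    have "maps_into f T S'" using f S'(1) by (rule maps_into_id_comp)
    then have "maps_into f (R \<union> {(x, y)}, {#(y, A), (x, Dia A)#} + G) S'"
      using S' unfolding 5 by (auto simp: maps_into_def)
    from one[OF 5(2) this] S'(3) 5(1) show ?thesis by simp
  next
    case (6 y R x A G)
    have A: "covers S (f x) (PastBox A)" by (rule maps_into_fm[OF f]) (simp add: 6)
    from past_box_step[OF A fin, of GP]
    obtain S' y' where S': "maps_into id S S'" "(y', f x) \<in> fst S'" "covers S' y' A"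
        "S' = S \<or> g3kt GP LPastBox [S'] S"
      by blast
    have x: "x \<noteq> y" using 6 by (auto simp: labels_def)
    have "maps_into f T S'" using f S'(1) by (rule maps_into_id_comp)
    then have "maps_into (f(y := y')) T S'" using 6 by (auto intro: maps_into_cong)
    then have "maps_into (f(y := y')) (R \<union> {(y, x)}, {#(y, A)#} + G) S'"
      using S' x unfolding 6 by (auto simp: maps_into_def)
    from one[OF 6(2) this] S'(4) 6(1) show ?thesis by simp
  next
    case (7 R y x A G)
    have A: "covers S (f x) (PastDia A)" by (rule maps_into_fm[OF f]) (simp add: 7)
    have "(f y, f x) \<in> fst S" by (rule maps_into_rel[OF f]) (simp add: 7)
    from past_dia_step[OF A this, of GP]
    obtain S' where S': "maps_into id S S'" "covers S' (f y) A" "g3kt GP LPastDia [S'] S"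
      by blast
    have "maps_into f T S'" using f S'(1) by (rule maps_into_id_comp)
    then have "maps_into f (R \<union> {(y, x)}, {#(y, A), (x, PastDia A)#} + G) S'"
      using S' unfolding 7 by (auto simp: maps_into_def)
    from one[OF 7(2) this] S'(3) 7(1) show ?thesis by simp
  next
    case (8 Pi Sig x us y vs R G)
    have "walk (fst T) Pi x y" using 8 walk_iff_path by auto
    then have "walk (fst S) Pi (f x) (f y)" using walk_map f by blast
    then obtain S' g where S': "maps_into g S S'" "walk (fst S') Sig (g (f x)) (g (f y))"
        "g3kt GP (LabSt (Pi, Sig)) [S'] S"
      using path_step[OF 8(4) _ fin] by blast
    obtain zs where zs: "path Sig (g (f x)) zs (g (f y))" "chain Sig zs \<subseteq> fst S'"
      using S'(2) walk_iff_path by blast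
    let ?I = "intermediate vs" and ?J = "intermediate zs"
    have vs_eq: "vs = x # ?I @ [y]" and zs_eq: "zs = g (f x) # ?J @ [g (f y)]"
      and len: "length ?I = length ?J"
      using path_intermediate[OF 8(7) 8(5)] path_intermediate[OF zs(1) 8(5)] by auto
    \<comment> \<open>The fresh labels of the original chain go to the corresponding labels of the
      path found in \<open>S'\<close>, all others follow \<open>g \<circ> f\<close>. Distinctness of
      the fresh labels makes this well defined; their images may repeat.\<close>
    define h where "h z = (case map_of (zip ?I ?J) z of Some w \<Rightarrow> w | None \<Rightarrow> g (f z))" for z
    have h: "h z = g (f z)" if "z \<notin> set ?I" for z
      using that map_of_zip_is_None[OF len, of z] by (simp add: h_def)
    have "map h ?I = ?J"
      using len 8(8) by (intro nth_equalityI) (auto simp: h_def map_of_zip_nth)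
    then have "map h vs = zs"
      using h 8(9) by (subst vs_eq, subst zs_eq) auto
    then have ch: "map_prod h h ` chain Sig vs = chain Sig zs"
      using chain_map[of vs Sig h] 8(7) by (simp add: path_def)
    have "maps_into (g \<circ> f) T S'" using f S'(1) by (rule maps_into_comp)
    \<comment> \<open>The intermediate labels avoid those of \<open>T\<close>, where
      \<open>h\<close> therefore agrees with \<open>g \<circ> f\<close>.\<close>
    then have hT: "maps_into h T S'" using h 8 by (force intro: maps_into_cong)
    have ch':  "(h a, h b) \<in> fst S'" if "(a, b) \<in> chain Sig vs" for a b
    proof -
      have "map_prod h h (a, b) \<in> chain Sig zs" using that ch by blast
      then show ?thesis using zs(2) by auto
    qed
    have "maps_into h (R \<union> chain Pi us \<union> chain Sig vs, G) S'"
      by (intro maps_intoI) (use maps_into_rel[OF hT] maps_into_fm[OF hT] ch' 8(3) in auto)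
    from one[OF 8(2) this] S'(3) 8(1) show ?thesis by simp
  next
    case (9 Pi x us y R G)
    have "walk (fst T) Pi x y" using 9 walk_iff_path by auto
    then have "walk (fst S) Pi (f x) (f y)" using walk_map f by blast
    then obtain S' g where S': "maps_into g S S'" "g (f x) = g (f y)"
        "g3kt GP (LabSt (Pi, [])) [S'] S"
      using path_step[OF 9(4) _ fin] unfolding walk.simps(1) by blast
    \<comment> \<open>The end points have the same image, so replacing \<open>y\<close> by
      \<open>x\<close> beforehand changes nothing and the map factors through the renamed
      premise.\<close>
    have "(g \<circ> f) \<circ> id(y := x) = g \<circ> f" using S'(2) by (auto simp: fun_eq_iff)
    then have "maps_into (g \<circ> f) (rename (id(y := x)) T) S'"
      using maps_into_comp[OF f S'(1)] by (simp add: maps_into_rename_iff)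
    then have "maps_into (g \<circ> f) (rename (id(y := x)) (R \<union> chain Pi us, G)) S'"
      unfolding 9(3) .
    from one[OF 9(2) this] S'(3) 9(1) show ?thesis by simp
  qed
qed

section \<open>Nested sequents inside labelled sequents\<close>

text \<open>A homomorphism from the tree of a nested sequent, with the root sent to
  \<open>x\<close>. It need not be injective: siblings may share a label, which is what makes
  contraction free.\<close>

inductive holds_node :: "'p labelled \<Rightarrow> label \<Rightarrow> 'p node \<Rightarrow> bool" for S where
  "covers S x A \<Longrightarrow> holds_node S x (Fm A)"
| "(x, y) \<in> fst S \<Longrightarrow> \<forall>n \<in># X. holds_node S y n \<Longrightarrow> holds_node S x (Circ X)"
| "(y, x) \<in> fst S \<Longrightarrow> \<forall>n \<in># X. holds_node S y n \<Longrightarrow> holds_node S x (Bullet X)"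

inductive_simps holds_node_Fm [simp]: "holds_node S x (Fm A)"

definition holds :: "'p labelled \<Rightarrow> label \<Rightarrow> 'p nested \<Rightarrow> bool" where
  "holds S x X \<longleftrightarrow> (\<forall>n \<in># X. holds_node S x n)"

lemma holds_simps [simp]:
  "holds S x {#}"
  "holds S x (add_mset n X) \<longleftrightarrow> holds_node S x n \<and> holds S x X"
  "holds S x (X + Y) \<longleftrightarrow> holds S x X \<and> holds S x Y"
  by (auto simp: holds_def)

lemma holds_node_Circ_Bullet [simp]:
  "holds_node S x (Circ X) \<longleftrightarrow> (\<exists>y. (x, y) \<in> fst S \<and> holds S y X)"
  "holds_node S x (Bullet X) \<longleftrightarrow> (\<exists>y. (y, x) \<in> fst S \<and> holds S y X)"
  by (simp_all add: holds_node.simps[of S x "Circ X"] holds_node.simps[of S x "Bullet X"] holds_def)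

lemma holds_node_map: "holds_node S x n \<Longrightarrow> maps_into f S T \<Longrightarrow> holds_node T (f x) n"
proof (induction rule: holds_node.induct)
  case (1 x A)
  then show ?case by (auto dest: covers_map)
next
  case (2 x y X)
  then show ?case unfolding holds_node_Circ_Bullet holds_def by (blast dest: maps_into_rel)
next
  case (3 y x X)
  then show ?case unfolding holds_node_Circ_Bullet holds_def by (blast dest: maps_into_rel)
qed

lemma holds_map: "maps_into f S T \<Longrightarrow> holds S x X \<Longrightarrow> holds T (f x) X"
  unfolding holds_def using holds_node_map by blast

lemma holds_map_id: "maps_into id S T \<Longrightarrow> holds S x X \<Longrightarrow> holds T x X"
  using holds_map[of id] by simp

text \<open>A string of nestings is a single branch, so mapping it amounts to walking along the
  string.\<close>

lemma holds_stars: "holds S x (stars ds Y) \<longleftrightarrow> (\<exists>y. walk (fst S) ds x y \<and> holds S y Y)"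
proof (induction ds arbitrary: x)
  case Nil
  then show ?case by (simp add: stars_def)
next
  case (Cons d ds)
  have "stars (d # ds) Y = star d (stars ds Y)" by (simp add: stars_def)
  then show ?case using Cons by (cases d) auto
qed

lemma translates_finite: "translates x X S \<Longrightarrow> finite (fst S)"
  by (induction rule: translates.induct) auto

text \<open>The tree maps identically into its own translation, each part of which is included in
  the whole.\<close>

lemma translates_holds: "translates x X S \<Longrightarrow> holds S x X"
proof (induction rule: translates.induct)
  case (3 x X1 R1 G1 X2 R2 G2)
  have "maps_into id (R1, G1) (R1 \<union> R2, G1 + G2)" "maps_into id (R2, G2) (R1 \<union> R2, G1 + G2)"
    by (auto intro!: maps_intoI covers_mem)
  from this[THEN holds_map_id] show ?case using 3 by auto
next
  case (4 y X R G x)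
  have "maps_into id (R, G) ({(x, y)} \<union> R, G)" by (auto intro!: maps_intoI covers_mem)
  from holds_map_id[OF this, of y X] show ?case using 4 by auto
next
  case (5 y X R G x)
  have "maps_into id (R, G) ({(y, x)} \<union> R, G)" by (auto intro!: maps_intoI covers_mem)
  from holds_map_id[OF this, of y X] show ?case using 5 by auto
qed (auto intro: covers_mem)

text \<open>This is initiality. By freshness the labels of \<open>S\<close> form a tree, so maps of
  the parts overlap only at the root and can be glued.\<close>

lemma translates_map: "translates x X S \<Longrightarrow> holds T x' X \<Longrightarrow> \<exists>f. f x = x' \<and> maps_into f S T"
proof (induction arbitrary: x' rule: translates.induct)
  case (1 x)
  then show ?case by (intro exI[of _ "\<lambda>_. x'"]) (auto simp: maps_into_def)
next
  case (2 x A)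
  then show ?case by (intro exI[of _ "\<lambda>_. x'"]) (auto simp: maps_into_def)
next
  case (3 x X1 R1 G1 X2 R2 G2)
  then obtain f1 f2 where f: "f1 x = x'" "maps_into f1 (R1, G1) T" "f2 x = x'" "maps_into f2 (R2, G2) T"
    by (metis holds_simps(3))
  \<comment> \<open>The only possible common label is \<open>x\<close>, where both maps take the
    value \<open>x'\<close>.\<close>
  let ?f = "\<lambda>z. if z \<in> labels (R1, G1) then f1 z else f2 z"
  have "maps_into ?f (R1, G1) T" using f by (auto intro: maps_into_cong)
  moreover have "maps_into ?f (R2, G2) T"
    using f(4)
  proof (rule maps_into_cong)
    fix z assume "z \<in> labels (R2, G2)"
    then show "?f z = f2 z" using f 3(3) by auto
  qed
  ultimately have "maps_into ?f (R1 \<union> R2, G1 + G2) T" by (auto simp: maps_into_def)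
  then show ?case using f by (intro exI[of _ ?f]) auto
next
  case (4 y X R G x)
  then obtain y' f where f: "(x', y') \<in> fst T" "f y = y'" "maps_into f (R, G) T"
    by (metis holds_node_Circ_Bullet(1) holds_simps(2))
  \<comment> \<open>The root \<open>x\<close> does not occur in the translation of the child, so its
    image is still free.\<close>
  have "maps_into (f(x := x')) (R, G) T" using f 4 by (auto intro: maps_into_cong)
  then have "maps_into (f(x := x')) ({(x, y)} \<union> R, G) T"
    using f 4 by (auto simp: maps_into_def)
  then show ?case by (meson fun_upd_same)
next
  case (5 y X R G x)
  then obtain y' f where f: "(y', x') \<in> fst T" "f y = y'" "maps_into f (R, G) T"
    by (metis holds_node_Circ_Bullet(2) holds_simps(2))
  have "maps_into (f(x := x')) (R, G) T" using f 5 by (auto intro: maps_into_cong)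
  then have "maps_into (f(x := x')) ({(y, x)} \<union> R, G) T"
    using f 5 by (auto simp: maps_into_def)
  then show ?case by (meson fun_upd_same)
qed

section \<open>Simulation of the nested rules\<close>

text \<open>Initiality supplies a map from \<open>L X\<close> into \<open>S\<close>, and the
  derivation is lifted along it. The label \<open>x\<close> is unrelated to the starting label used
  by \<open>L\<close>.\<close>

lemma derives_where_holds:
  assumes "sequent_translation L" "derives (g3kt GP) d" "concl d = L X" "holds S x X"
    "finite (fst S)"
  shows "\<exists>e. derives (g3kt GP) e \<and> concl e = S \<and> embeds e d"
proof -
  obtain y where "translates y X (L X)" using assms(1) by (auto simp: sequent_translation_def)
  then obtain f where "maps_into f (L X) S" using translates_map assms(4) by blast
  then show ?thesis using lift_map assms(2,3,5) by metis
qed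

text \<open>Premises that embed into the given derivations count as zero inferences, which leaves
  only the new one.\<close>

lemma built_Infer:
  assumes "\<forall>e \<in> set es'. \<exists>d \<in> set es. embeds e d"
  shows "built es 1 (Infer r S es')"
proof -
  have "list_all2 (built es) (replicate (length es') 0) es'"
    using assms by (auto simp: list_all2_conv_all_nth intro: built.intros(1))
  then show ?thesis using built.intros(2)[of es "replicate (length es') 0" es' r S]
    by (simp add: sum_list_replicate)
qed

text \<open>The given derivation lifts to \<open>S'\<close> at no cost, and at most one inference
  leads from there to \<open>S\<close>. The structural and display rules take
  \<open>S' = S\<close>.\<close>

lemma simulate_one_premise:
  assumes "sequent_translation L" "\<forall>e \<in> set es. derives (g3kt GP) e" "map concl es = [L Y]"
    "S' = S \<or> g3kt GP r [S'] S" "holds S' x Y" "finite (fst S)"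
  shows "\<exists>e. derives (g3kt GP) e \<and> concl e = S \<and> (\<exists>n \<le> 1. built es n e)"
proof -
  obtain d where d: "es = [d]" "concl d = L Y"
    using assms(3) by (auto simp: map_eq_Cons_conv)
  have "finite (fst S')" using assms(4,6) by (auto dest: g3kt_finite)
  then obtain e where e: "derives (g3kt GP) e" "concl e = S'" "embeds e d"
    using derives_where_holds[OF assms(1) _ d(2) assms(5)] assms(2) d(1) by auto
  show ?thesis
  proof (cases "S' = S")
    case True
    then show ?thesis using e d built.intros(1)[of d es e] by (intro exI[of _ e]) auto
  next
    case False
    then have "derives (g3kt GP) (Infer r S [e])" using assms(4) e by (intro derives_Infer1) auto
    moreover have "built es 1 (Infer r S [e])" using e d by (intro built_Infer) auto
    ultimately show ?thesis by (intro exI[of _ "Infer r S [e]"]) auto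
  qed
qed

text \<open>The conclusion holds in its own translation. Reading the nested rule upwards, the
  premises hold there as well or do so after one labelled rule applied bottom up.\<close>

lemma simulate_rule:
  assumes L: "sequent_translation L" and skt: "skt GP r Xs X"
    and es: "\<forall>e \<in> set es. derives (g3kt GP) e" "map concl es = map L Xs"
  shows "\<exists>e. derives (g3kt GP) e \<and> concl e = L X \<and> (\<exists>n \<le> 1. built es n e)"
proof -
  obtain x where "translates x X (L X)" using L by (auto simp: sequent_translation_def)
  then have X: "holds (L X) x X" and fin: "finite (fst (L X))"
    using translates_holds translates_finite by blast+
  have one: ?thesis if "Xs = [Y]" "holds S' y Y" "S' = L X \<or> g3kt GP r' [S'] (L X)" for Y S' y r'
    using simulate_one_premise[OF L es(1) _ that(3,2) fin] es(2) that(1) by simp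
  from skt show ?thesis
  proof cases
    case (1 Y p)
    then have "g3kt GP LId [] (L X)" using X id_step[of "L X" x p] by auto
    then have "derives (g3kt GP) (Infer LId (L X) [])" by (intro derives.intros) auto
    moreover have "built es 1 (Infer LId (L X) [])" by (rule built_Infer) simp
    ultimately show ?thesis by (intro exI[of _ "Infer LId (L X) []"]) auto
  next
    case (2 Y A B)
    then have Y: "holds (L X) x Y" "covers (L X) x (Or A B)" using X by auto
    from or_step[OF Y(2), of GP] obtain S' where S': "maps_into id (L X) S'" "covers S' x A"
        "covers S' x B" "S' = L X \<or> g3kt GP LOr [S'] (L X)"
      by blast
    then have "holds S' x (Y + {#Fm A, Fm B#})" using holds_map_id[OF S'(1) Y(1)] by auto
    then show ?thesis using 2 S'(4) one by blast
  next
    case (3 Y A B)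
    then have Y: "holds (L X) x Y" "covers (L X) x (And A B)" using X by auto
    obtain d1 d2 where ds: "es = [d1, d2]" "concl d1 = L (Y + {#Fm A#})" "concl d2 = L (Y + {#Fm B#})"
      using es(2) 3 by (auto simp: map_eq_Cons_conv)
    then have d: "derives (g3kt GP) d1" "derives (g3kt GP) d2" using es(1) by auto
    note lift1 = derives_where_holds[OF L d(1) ds(2)] and lift2 = derives_where_holds[OF L d(2) ds(3)]
    from and_step[OF Y(2), of GP] show ?thesis
    proof (elim disjE exE conjE)
      assume "covers (L X) x A"
      then obtain e where "derives (g3kt GP) e" "concl e = L X" "embeds e d1"
        using lift1[of "L X" x] Y fin by auto
      then show ?thesis using built.intros(1)[of d1 es e] ds by (intro exI[of _ e]) auto
    next
      assume "covers (L X) x B"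
      then obtain e where "derives (g3kt GP) e" "concl e = L X" "embeds e d2"
        using lift2[of "L X" x] Y fin by auto
      then show ?thesis using built.intros(1)[of d2 es e] ds by (intro exI[of _ e]) auto
    next
      fix S1 S2
      assume *: "maps_into id (L X) S1" "covers S1 x A" "maps_into id (L X) S2" "covers S2 x B"
        "g3kt GP LAnd [S1, S2] (L X)"
      have "finite (fst S1)" "finite (fst S2)" using g3kt_finite[OF *(5) fin] by auto
      moreover have "holds S1 x Y" "holds S2 x Y" using * Y holds_map_id by blast+
      ultimately obtain e1 e2 where e: "derives (g3kt GP) e1" "concl e1 = S1" "embeds e1 d1"
          "derives (g3kt GP) e2" "concl e2 = S2" "embeds e2 d2"
        using lift1[of S1 x] lift2[of S2 x] * by auto
      have "derives (g3kt GP) (Infer LAnd (L X) [e1, e2])"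
        using e * by (intro derives.intros) auto
      moreover have "built es 1 (Infer LAnd (L X) [e1, e2])"
        using e ds by (intro built_Infer) auto
      ultimately show ?thesis by (intro exI[of _ "Infer LAnd (L X) [e1, e2]"]) auto
    qed
  next
    case (4 Y Z)
    \<comment> \<open>Both copies of \<open>Z\<close> are mapped to the same labels.\<close>
    then have "holds (L X) x (Y + Z + Z)" using X by auto
    then show ?thesis using 4 one by blast
  next
    case (5 Y)
    then have "holds (L X) x Y" using X by auto
    then show ?thesis using 5 one by blast
  next
    case (6 Y Z)
    \<comment> \<open>Display only moves the root: seen from the label \<open>y\<close> of the
      bullet, \<open>Z\<close> sits at its successor \<open>x\<close>.\<close>
    then obtain y where "holds (L X) y (Y + {#Circ Z#})" using X by auto
    then show ?thesis using 6 one by blast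
  next
    case (7 Y Z)
    then obtain y where "holds (L X) y (Y + {#Bullet Z#})" using X by auto
    then show ?thesis using 7 one by blast
  next
    case (8 Y A)
    then have Y: "holds (L X) x Y" "covers (L X) x (PastBox A)" using X by auto
    from past_box_step[OF Y(2) fin, of GP] obtain S' y where S': "maps_into id (L X) S'"
        "(y, x) \<in> fst S'" "covers S' y A" "S' = L X \<or> g3kt GP LPastBox [S'] (L X)"
      by blast
    then have "holds S' x (Y + {#Bullet {#Fm A#}#})" using holds_map_id[OF S'(1) Y(1)] by auto
    then show ?thesis using 8 S'(4) one by blast
  next
    case (9 Y A)
    then have Y: "holds (L X) x Y" "covers (L X) x (Box A)" using X by auto
    from box_step[OF Y(2) fin, of GP] obtain S' y where S': "maps_into id (L X) S'"
        "(x, y) \<in> fst S'" "covers S' y A" "S' = L X \<or> g3kt GP LBox [S'] (L X)"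
      by blast
    then have "holds S' x (Y + {#Circ {#Fm A#}#})" using holds_map_id[OF S'(1) Y(1)] by auto
    then show ?thesis using 9 S'(4) one by blast
  next
    case (10 Y Z A)
    then obtain y where Y: "holds (L X) x Y" "(y, x) \<in> fst (L X)" "holds (L X) y Z"
        "covers (L X) x (PastDia A)"
      using X by auto
    from past_dia_step[OF Y(4,2), of GP] obtain S' where S': "maps_into id (L X) S'"
        "covers S' y A" "g3kt GP LPastDia [S'] (L X)"
      by blast
    have "(y, x) \<in> fst S'" using maps_into_rel[OF S'(1) Y(2)] by simp
    moreover have "covers S' x (PastDia A)" using covers_map[OF S'(1) Y(4)] by simp
    moreover have "holds S' x Y" "holds S' y Z" using S'(1) Y holds_map_id by blast+
    ultimately have "holds S' x (Y + {#Bullet (Z + {#Fm A#})#} + {#Fm (PastDia A)#})"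
      using S'(2) by auto
    then show ?thesis using 10 S'(3) one by blast
  next
    case (11 Y Z A)
    then obtain y where Y: "holds (L X) x Y" "(x, y) \<in> fst (L X)" "holds (L X) y Z"
        "covers (L X) x (Dia A)"
      using X by auto
    from dia_step[OF Y(4,2), of GP] obtain S' where S': "maps_into id (L X) S'"
        "covers S' y A" "g3kt GP LDia [S'] (L X)"
      by blast
    have "(x, y) \<in> fst S'" using maps_into_rel[OF S'(1) Y(2)] by simp
    moreover have "covers S' x (Dia A)" using covers_map[OF S'(1) Y(4)] by simp
    moreover have "holds S' x Y" "holds S' y Z" using S'(1) Y holds_map_id by blast+
    ultimately have "holds S' x (Y + {#Circ (Z + {#Fm A#})#} + {#Fm (Dia A)#})"
      using S'(2) by auto
    then show ?thesis using 11 S'(3) one by blast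
  next
    case (12 Pi Sig Y Z)
    then obtain y where Y: "holds (L X) x Y" "walk (fst (L X)) Pi x y" "holds (L X) y Z"
      using X by (auto simp: holds_stars)
    \<comment> \<open>The conclusion provides the walk along \<open>Pi\<close>; the labelled rule
      adds one along \<open>Sig\<close> between the same ends, so \<open>Z\<close> is reached
      through \<open>Sig\<close> as well. The map \<open>g\<close> accounts for ends that are
      merged.\<close>
    from path_step[OF 12(4) Y(2) fin] obtain S' g where S': "maps_into g (L X) S'"
        "walk (fst S') Sig (g x) (g y)" "g3kt GP (LabSt (Pi, Sig)) [S'] (L X)"
      by blast
    then have "holds S' (g x) (Y + stars Sig Z)" using holds_map[OF S'(1)] Y by (auto simp: holds_stars)
    then show ?thesis using 12 S'(3) one by blast
  qed
qed

theorem theorem4p3: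
  fixes GP :: "gp_axiom set"
    and L :: "'p nested \<Rightarrow> 'p labelled"
  assumes "sequent_translation L"
  shows "\<exists>T. effective_translation GP L T \<and>
           (\<forall>D X. derives (skt GP) D \<and> concl D = X \<longrightarrow>
              derives (g3kt GP) (T D) \<and> concl (T D) = L X)"
proof -
  \<comment> \<open>Choice turns the existence of a simulating derivation into a function; on
    arguments that are not correct inferences its value is arbitrary. The bound 1 serves every
    rule.\<close>
  define step where "step = (\<lambda>(r :: nested_rule) (Xs :: 'p nested list) X es.
      SOME e. derives (g3kt GP) e \<and> concl e = L X \<and> (\<exists>n \<le> 1. built es n e))"
  have step: "derives (g3kt GP) (step r Xs X es) \<and> concl (step r Xs X es) = L X \<and>
      (\<exists>n \<le> 1. built es n (step r Xs X es))"
    if "skt GP r Xs X" "\<forall>e \<in> set es. derives (g3kt GP) e" "map concl es = map L Xs" for r Xs X es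
    unfolding step_def using simulate_rule[OF assms that] by (rule someI_ex)
  then have "local_simulation GP L step"
    unfolding local_simulation_def by (intro exI[of _ "\<lambda>_. 1"]) blast
  moreover have "derives (g3kt GP) (rule_by_rule step D) \<and> concl (rule_by_rule step D) = L (concl D)"
    if "derives (skt GP) D" for D
    using that
  proof (induction rule: derives.induct)
    case (1 r ds X)
    let ?es = "map (rule_by_rule step) ds"
    have "\<forall>e \<in> set ?es. derives (g3kt GP) e" "map concl ?es = map L (map concl ds)"
      using 1(2) by simp_all
    from step[OF 1(1) this] show ?case by simp
  qed
  ultimately show ?thesis unfolding effective_translation_def by blast
qed

end
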